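(* Let $X$ be a finite alphabet. If $|X|\geq 2$, then in the semigroup $\mathcal{ISA}(X)$ there are conjugacy classes (equivalence classes of $\sim$) which contain no group elements.
   Context: An initial (partial Mealy) automaton over a finite alphabet $X$ consists of a set $Q$ of internal states, a partial transition function $\varphi:Q\times X\to Q$, a partial output function $\psi:Q\times X\to X$ and an initial state $q_0\in Q$. Extend $\varphi$ to words by $\varphi(q,e)=q$ ($e$ the empty word), $\varphi(q,wx)=\varphi(\varphi(q,w),x)$. The automaton defines the partial transformation of the set $X^*$ of all words over $X$ sending $u=x_1x_2x_3\dots$ to $\psi(q_0,x_1)\psi(\varphi(q_0,x_1),x_2)\psi(\varphi(q_0,x_1x_2),x_3)\dots$, undefined iff at least one of the values of $\varphi$ or $\psi$ in this expression is undefined. A partial automatic permutation is an injective partial transformation of $X^*$ defined in this way; these form an inverse semigroup $\mathcal{ISA}(X)$ under composition of partial maps. In a semigroup $S$, a group element is an element belonging to some subgroup of $S$. Write $a\sim_p b$ if $a=xy$, $b=yx$ for some $x,y\in S$; the relation $\sim$ (conjugacy) is the transitive closure of $\sim_p$, and conjugacy classes are the classes of $\sim$. *)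

theory Defs
  imports "HOL-Algebra.Group" "HOL-Library.Cardinality"
begin

text \<open>
  The alphabet is a type \<open>'x\<close>, so that \<open>'x list\<close> is the set of all words. An initial partial Mealy
  automaton is a tuple \<open>(Q, \<phi>, \<psi>, q0)\<close>; partial functions are maps into \<open>option\<close>.
\<close>

definition initial_automaton ::
    "'q set \<Rightarrow> ('q \<times> 'x \<rightharpoonup> 'q) \<Rightarrow> ('q \<times> 'x \<rightharpoonup> 'x) \<Rightarrow> 'q \<Rightarrow> bool" where
  "initial_automaton Q \<phi> \<psi> q0 \<longleftrightarrow>
     q0 \<in> Q \<and> dom \<phi> \<subseteq> Q \<times> UNIV \<and> ran \<phi> \<subseteq> Q \<and> dom \<psi> \<subseteq> Q \<times> UNIV"

definition trans_word :: "('q \<times> 'x \<rightharpoonup> 'q) \<Rightarrow> 'q \<Rightarrow> 'x list \<Rightarrow> 'q option" where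
  "trans_word \<phi> q w = foldl (\<lambda>s x. Option.bind s (\<lambda>p. \<phi> (p, x))) (Some q) w"

lemma trans_word_Nil [simp]: "trans_word \<phi> q [] = Some q"
  by (simp add: trans_word_def)

lemma trans_word_snoc [simp]:
  "trans_word \<phi> q (w @ [x]) = Option.bind (trans_word \<phi> q w) (\<lambda>p. \<phi> (p, x))"
  by (simp add: trans_word_def)

text \<open>The letter \<open>\<psi> (\<phi> (q0, x\<^sub>1 \<dots> x\<^sub>i), x\<^sub>i\<^sub>+\<^sub>1)\<close> (positions in a list are counted from 0).\<close>

definition out_letter ::
    "('q \<times> 'x \<rightharpoonup> 'q) \<Rightarrow> ('q \<times> 'x \<rightharpoonup> 'x) \<Rightarrow> 'q \<Rightarrow> 'x list \<Rightarrow> nat \<Rightarrow> 'x option" where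
  "out_letter \<phi> \<psi> q0 u i =
     Option.bind (trans_word \<phi> q0 (take i u)) (\<lambda>q. \<psi> (q, u ! i))"

text \<open>
  The value of \<open>\<phi>\<close> after the last letter of \<open>u\<close> does not occur in the output expression, so it is
  not required to be defined. The empty word is always mapped to itself.
\<close>

definition automaton_map ::
    "('q \<times> 'x \<rightharpoonup> 'q) \<Rightarrow> ('q \<times> 'x \<rightharpoonup> 'x) \<Rightarrow> 'q \<Rightarrow> ('x list \<rightharpoonup> 'x list)" where
  "automaton_map \<phi> \<psi> q0 u =
     (if \<forall>i<length u. out_letter \<phi> \<psi> q0 u i \<noteq> None
      then Some (map (\<lambda>i. the (out_letter \<phi> \<psi> q0 u i)) [0..<length u])
      else None)"

text \<open>
  A definition cannot quantify over the type of states. Taking state sets \<open>Q\<close> in \<open>'x list\<close> loses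
  nothing: see the lemma \<open>automaton_map_realizable\<close> below, which covers state sets in any type.
\<close>

definition partial_automatic_permutation :: "('x list \<rightharpoonup> 'x list) \<Rightarrow> bool" where
  "partial_automatic_permutation f \<longleftrightarrow>
     inj_on f (dom f) \<and>
     (\<exists>(Q :: 'x list set) \<phi> \<psi> q0. initial_automaton Q \<phi> \<psi> q0 \<and> f = automaton_map \<phi> \<psi> q0)"

lemma automaton_map_realizable:
  fixes Q :: "'q set" and \<phi> :: "'q \<times> 'x \<rightharpoonup> 'q"
  assumes "initial_automaton Q \<phi> \<psi> q0"
  shows "\<exists>(Q' :: 'x list set) \<phi>' \<psi>' q0'.
           initial_automaton Q' \<phi>' \<psi>' q0' \<and> automaton_map \<phi>' \<psi>' q0' = automaton_map \<phi> \<psi> q0"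
proof -
  define \<phi>' :: "'x list \<times> 'x \<rightharpoonup> 'x list" where
    "\<phi>' = (\<lambda>(w, x). map_option (\<lambda>_. w @ [x]) (trans_word \<phi> q0 (w @ [x])))"
  define \<psi>' :: "'x list \<times> 'x \<rightharpoonup> 'x" where
    "\<psi>' = (\<lambda>(w, x). Option.bind (trans_word \<phi> q0 w) (\<lambda>q. \<psi> (q, x)))"
  have tw: "trans_word \<phi>' [] w = map_option (\<lambda>_. w) (trans_word \<phi> q0 w)" for w
    by (induction w rule: rev_induct) (auto simp: \<phi>'_def split: bind_splits)
  have "out_letter \<phi>' \<psi>' [] u i = out_letter \<phi> \<psi> q0 u i" for u i
    by (cases "trans_word \<phi> q0 (take i u)") (auto simp: out_letter_def tw \<psi>'_def)
  then have "automaton_map \<phi>' \<psi>' [] = automaton_map \<phi> \<psi> q0"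
    by (simp add: automaton_map_def fun_eq_iff)
  moreover have "initial_automaton UNIV \<phi>' \<psi>' []"
    by (simp add: initial_automaton_def)
  ultimately show ?thesis by blast
qed

text \<open>
  The semigroup contains the identity map, so it is presented as a monoid; none of the notions
  below refers to the field \<open>one\<close> of this structure.
\<close>

definition ISA :: "('x list \<rightharpoonup> 'x list) monoid" where
  "ISA = \<lparr>carrier = {f. partial_automatic_permutation f}, mult = (\<circ>\<^sub>m), one = Some\<rparr>"

text \<open>A subgroup of a semigroup is a subset that is a group under the given product; its identity
  \<open>e\<close> is some idempotent, in general not the identity of the whole structure.\<close>

definition group_element :: "('a, 'b) monoid_scheme \<Rightarrow> 'a \<Rightarrow> bool" where
  "group_element S a \<longleftrightarrow>
     (\<exists>H e. H \<subseteq> carrier S \<and> a \<in> H \<and> group (S\<lparr>carrier := H, one := e\<rparr>))"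

definition primary_conjugacy :: "('a, 'b) monoid_scheme \<Rightarrow> ('a \<times> 'a) set" where
  "primary_conjugacy S =
     {(a, b). a \<in> carrier S \<and> b \<in> carrier S \<and>
       (\<exists>x\<in>carrier S. \<exists>y\<in>carrier S. a = x \<otimes>\<^bsub>S\<^esub> y \<and> b = y \<otimes>\<^bsub>S\<^esub> x)}"

definition conjugacy :: "('a, 'b) monoid_scheme \<Rightarrow> ('a \<times> 'a) set" where
  "conjugacy S = (primary_conjugacy S)\<^sup>+"

text \<open>The quotient by \<open>conjugacy ISA\<close> is a genuine set of equivalence classes, none of them empty.\<close>

lemma one_in_ISA: "(Some :: 'x list \<rightharpoonup> 'x list) \<in> carrier ISA"
proof -
  define \<phi> :: "'x list \<times> 'x \<rightharpoonup> 'x list" where "\<phi> = (\<lambda>_. Some [])"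
  define \<psi> :: "'x list \<times> 'x \<rightharpoonup> 'x" where "\<psi> = (\<lambda>(_, x). Some x)"
  have "trans_word \<phi> [] w = Some []" for w
    by (induction w rule: rev_induct) (auto simp: \<phi>_def)
  then have "out_letter \<phi> \<psi> [] u i = Some (u ! i)" for u i
    by (simp add: out_letter_def \<psi>_def)
  then have "(Some :: 'x list \<rightharpoonup> 'x list) = automaton_map \<phi> \<psi> []"
    by (simp add: automaton_map_def fun_eq_iff map_nth)
  moreover have "initial_automaton UNIV \<phi> \<psi> []"
    by (simp add: initial_automaton_def)
  ultimately have "partial_automatic_permutation (Some :: 'x list \<rightharpoonup> 'x list)"
    unfolding partial_automatic_permutation_def by (metis inj_Some inj_on_subset subset_UNIV)
  then show ?thesis by (simp add: ISA_def)
qed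

lemma equiv_conjugacy_ISA:
  "equiv (carrier (ISA :: ('x list \<rightharpoonup> 'x list) monoid)) (conjugacy ISA)"
proof (rule equivI)
  show "conjugacy ISA \<subseteq> carrier ISA \<times> carrier ISA"
    unfolding conjugacy_def by (rule trancl_subset_Sigma) (auto simp: primary_conjugacy_def)
  have "(a, a) \<in> primary_conjugacy ISA" if "a \<in> carrier ISA" for a :: "'x list \<rightharpoonup> 'x list"
  proof -
    have "a = a \<otimes>\<^bsub>ISA\<^esub> Some" "a = Some \<otimes>\<^bsub>ISA\<^esub> a"
      by (auto simp: ISA_def map_comp_def fun_eq_iff split: option.splits)
    then show ?thesis
      using that one_in_ISA unfolding primary_conjugacy_def by blast
  qed
  then show "refl_on (carrier (ISA :: ('x list \<rightharpoonup> 'x list) monoid)) (conjugacy ISA)"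
    by (auto simp: refl_on_def conjugacy_def)
  have "sym (primary_conjugacy ISA)"
    by (auto simp: sym_def primary_conjugacy_def)
  then show "sym (conjugacy ISA)"
    unfolding conjugacy_def by (rule sym_trancl)
  show "trans (conjugacy ISA)"
    by (simp add: conjugacy_def)
qed

end

theory Submission
  imports Defs "HOL-Combinatorics.Transposition"
begin

text \<open>
  Say that a word \<open>w\<close> is transient for a partial map \<open>f\<close> if some iterate of \<open>f\<close> is undefined at \<open>w\<close>.
  The proof separates conjugacy classes by asking whether transient words leave the domain within a
  bounded number of steps.

  If \<open>a = x y\<close> and \<open>b = y x\<close>, then \<open>b\<^sup>m\<^sup>+\<^sup>1 = y a\<^sup>m x\<close>, so a bound for \<open>a\<close> yields a bound for \<open>b\<close> that is
  larger by one (\<open>bounded_transience_swap\<close>). Boundedness is therefore a conjugacy invariant. A group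
  element \<open>g\<close> satisfies \<open>g = g\<^sup>-\<^sup>1 g g\<close>, hence maps its domain into itself, and has transience bound 1
  (\<open>group_element_bounded_transience\<close>). It remains to find a partial automatic permutation
  with unbounded transience; its class then contains no group element.

  Fix two letters \<open>z \<noteq> o1\<close>. The permutation keeps a prefix \<open>z\<^sup>n o1\<close> and acts below it as a binary
  counter with \<open>n\<close> digits, least significant digit first, that refuses to overflow: if all \<open>n\<close> digits
  are \<open>o1\<close>, it is undefined on every longer word. A word with \<open>n\<close> digits \<open>z\<close> and one additional letter
  then survives exactly \<open>2\<^sup>n - 1\<close> steps (\<open>iterate_Carry\<close>). The additional letter is essential: on
  the \<open>n\<close> digits alone the counter wraps around and is a permutation. The prefix \<open>z\<^sup>n o1\<close> puts counters
  of all lengths into one tree.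
\<close>

section \<open>Bounded transience\<close>

definition iterate :: "('a \<rightharpoonup> 'a) \<Rightarrow> nat \<Rightarrow> ('a \<rightharpoonup> 'a)" where
  "iterate f n w = ((\<lambda>s. Option.bind s f) ^^ n) (Some w)"

lemma iterate_0 [simp]: "iterate f 0 w = Some w"
  by (simp add: iterate_def)

lemma iterate_Suc: "iterate f (Suc n) w = Option.bind (iterate f n w) f"
  by (simp add: iterate_def)

lemma iterate_add: "iterate f (m + n) w = Option.bind (iterate f m w) (iterate f n)"
  by (induction n) (simp_all add: iterate_Suc)

lemma iterate_mult: "iterate f (k * n) w = iterate (iterate f k) n w"
  by (induction n) (simp_all add: iterate_Suc iterate_add add.commute[of k])

lemma iterate_semiconjugate:
  assumes "\<And>u. f (g u) = map_option g (h u)"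
  shows "iterate f n (g u) = map_option g (iterate h n u)"
proof (induction n)
  case (Suc n)
  then show ?case
    by (cases "iterate h n u") (simp_all add: iterate_Suc assms)
qed simp

lemma iterate_mono_domain:
  assumes "iterate f n w \<noteq> None" "m \<le> n"
  shows "iterate f m w \<noteq> None"
  using assms iterate_add[of f m "n - m" w] by (cases "iterate f m w") auto

definition bounded_transience :: "('a \<rightharpoonup> 'a) \<Rightarrow> bool" where
  "bounded_transience f \<longleftrightarrow> (\<exists>k. \<forall>w m. iterate f k w \<noteq> None \<longrightarrow> iterate f m w \<noteq> None)"

lemma iterate_swap:
  "iterate (y \<circ>\<^sub>m x) (Suc m) w =
     Option.bind (Option.bind (x w) (iterate (x \<circ>\<^sub>m y) m)) y"
proof (induction m)
  case 0
  show ?case by (simp add: iterate_Suc map_comp_def split: option.splits bind_splits)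
next
  case (Suc m)
  show ?case
    unfolding iterate_Suc[of "y \<circ>\<^sub>m x" "Suc m"] Suc
    by (simp add: iterate_Suc map_comp_def Option.bind_assoc
        split: option.splits bind_splits)
qed

lemma bounded_transience_swap:
  assumes "bounded_transience (x \<circ>\<^sub>m y)"
  shows "bounded_transience (y \<circ>\<^sub>m x)"
proof -
  obtain k where k: "\<And>w m. iterate (x \<circ>\<^sub>m y) k w \<noteq> None \<Longrightarrow> iterate (x \<circ>\<^sub>m y) m w \<noteq> None"
    using assms unfolding bounded_transience_def by blast
  have "iterate (y \<circ>\<^sub>m x) m w \<noteq> None" if survives: "iterate (y \<circ>\<^sub>m x) (Suc k) w \<noteq> None" for w m
  proof (cases m)
    case (Suc j)
    obtain v where v: "x w = Some v" "iterate (x \<circ>\<^sub>m y) k v \<noteq> None"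
      using survives unfolding iterate_swap by (cases "x w") (auto simp: Option.bind_eq_Some_conv)
    \<comment> \<open>One step more than \<open>j\<close> is used, because the last application of \<open>y\<close> belongs to that step.\<close>
    from k[OF v(2), of "Suc j"]
    obtain u where "iterate (x \<circ>\<^sub>m y) j v = Some u" "y u \<noteq> None"
      by (cases "iterate (x \<circ>\<^sub>m y) j v")
        (auto simp: iterate_Suc map_comp_def split: option.splits)
    then show ?thesis
      by (simp add: Suc iterate_swap v(1))
  qed simp
  then show ?thesis unfolding bounded_transience_def by blast
qed

lemma conjugacy_bounded_transience:
  assumes "(a, b) \<in> conjugacy ISA" "bounded_transience b"
  shows "bounded_transience a"
proof -
  have step: "bounded_transience c"
    if cd: "(c, d) \<in> primary_conjugacy ISA" and d: "bounded_transience d" for c d :: "'a list \<rightharpoonup> 'a list"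
  proof -
    obtain x y where "c = x \<circ>\<^sub>m y" "d = y \<circ>\<^sub>m x"
      using cd by (auto simp: primary_conjugacy_def ISA_def)
    with d show ?thesis
      by (simp add: bounded_transience_swap[of y x])
  qed
  from assms show ?thesis
    unfolding conjugacy_def by (induction rule: trancl_induct) (auto dest: step)
qed

lemma group_element_bounded_transience:
  assumes "group_element ISA g"
  shows "bounded_transience g"
proof -
  obtain H e where "g \<in> H" and grp: "group (ISA\<lparr>carrier := H, one := e\<rparr>)"
    using assms unfolding group_element_def by blast
  then obtain h where "h \<in> H" and h: "h \<otimes>\<^bsub>ISA\<^esub> g = e"
    using group.l_inv_ex[OF grp] by auto
  have "e \<otimes>\<^bsub>ISA\<^esub> g = g"
    using monoid.l_one[OF group.is_monoid[OF grp]] \<open>g \<in> H\<close> by simp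
  with h have absorb: "(h \<circ>\<^sub>m g) \<circ>\<^sub>m g = g"
    by (simp add: ISA_def)
  have invariant: "g v \<noteq> None" if "g w = Some v" for v w
    using fun_cong[OF absorb, of w] that by (cases "g v") auto
  have "iterate g (Suc m) w \<noteq> None" if "g w \<noteq> None" for w m
  proof (induction m)
    case (Suc m)
    obtain u where "iterate g m w = Some u" "g u \<noteq> None"
      using Suc by (auto simp: iterate_Suc Option.bind_eq_Some_conv)
    then show ?case
      using invariant by (auto simp: iterate_Suc)
  qed (simp add: iterate_Suc that)
  then have "iterate g m w \<noteq> None" if "iterate g 1 w \<noteq> None" for w m
    using that by (cases m) (auto simp: iterate_Suc)
  then show ?thesis
    unfolding bounded_transience_def by blast
qed

section \<open>Automata with total transition function\<close>

lemma trans_word_Cons: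
  "trans_word \<phi> q (x # w) = Option.bind (\<phi> (q, x)) (\<lambda>p. trans_word \<phi> p w)"
  by (induction w rule: rev_induct)
    (simp_all add: trans_word_snoc[of \<phi> q "x # _", simplified] trans_word_def[of \<phi> q "[x]"])

lemma automaton_map_Nil: "automaton_map \<phi> \<psi> q [] = Some []"
  by (simp add: automaton_map_def)

text \<open>
  For a partial \<open>\<phi>\<close> this recursion would fail at words of length 1, where the state reached after
  the last letter does not matter.
\<close>

lemma automaton_map_Cons:
  "automaton_map (\<lambda>p. Some (\<delta> p)) \<psi> q (x # u) =
     Option.bind (\<psi> (q, x))
       (\<lambda>y. map_option ((#) y) (automaton_map (\<lambda>p. Some (\<delta> p)) \<psi> (\<delta> (q, x)) u))"
proof -
  have 0: "out_letter (\<lambda>p. Some (\<delta> p)) \<psi> q (x # u) 0 = \<psi> (q, x)"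
    by (simp add: out_letter_def)
  have Suc: "out_letter (\<lambda>p. Some (\<delta> p)) \<psi> q (x # u) (Suc i) =
      out_letter (\<lambda>p. Some (\<delta> p)) \<psi> (\<delta> (q, x)) u i" for i
    by (simp add: out_letter_def trans_word_Cons)
  show ?thesis
    by (cases "\<psi> (q, x)")
      (simp_all add: automaton_map_def All_less_Suc2 0 Suc map_upt_Suc del: upt_Suc)
qed

lemma inj_on_automaton_map:
  assumes "\<And>q x x'. \<psi> (q, x) \<noteq> None \<Longrightarrow> \<psi> (q, x) = \<psi> (q, x') \<Longrightarrow> x = x'"
  shows "inj_on (automaton_map (\<lambda>p. Some (\<delta> p)) \<psi> q) (dom (automaton_map (\<lambda>p. Some (\<delta> p)) \<psi> q))"
proof -
  let ?F = "automaton_map (\<lambda>p. Some (\<delta> p)) \<psi>"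
  have "u = v" if "?F q u = Some w" "?F q v = Some w" for u v w
    using that
  proof (induction u arbitrary: q v w)
    case Nil
    then show ?case
      by (cases v) (auto simp: automaton_map_Nil automaton_map_Cons Option.bind_eq_Some_conv)
  next
    case (Cons x u)
    then obtain x' v' where v: "v = x' # v'"
      by (cases v) (auto simp: automaton_map_Nil automaton_map_Cons Option.bind_eq_Some_conv)
    with Cons.prems obtain y w' where
      y: "\<psi> (q, x) = Some y" "\<psi> (q, x') = Some y" and
      w': "?F (\<delta> (q, x)) u = Some w'" "?F (\<delta> (q, x')) v' = Some w'"
      by (auto simp: automaton_map_Cons Option.bind_eq_Some_conv)
    have "x = x'"
      using y assms[of q x x'] by simp
    then show ?case
      using v w' Cons.IH by simp
  qed
  then show ?thesis
    by (auto intro!: inj_onI)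
qed

section \<open>A permutation with unbounded transience\<close>

text \<open>
  \<open>Prefix n\<close> has read \<open>z\<^sup>n\<close>; \<open>Carry n\<close> still has to add a carry to the remaining \<open>n\<close> digits; \<open>Copy\<close> has
  absorbed the carry.
\<close>

datatype counter_state = Prefix nat | Carry nat | Copy

fun counter_next :: "'x \<Rightarrow> 'x \<Rightarrow> counter_state \<times> 'x \<Rightarrow> counter_state" where
  "counter_next z o1 (Prefix n, x) = (if x = z then Prefix (Suc n) else Carry n)"
| "counter_next z o1 (Carry n, x) = (if x = o1 then Carry (n - 1) else Copy)"
| "counter_next z o1 (Copy, x) = Copy"

text \<open>\<open>Carry 0\<close> is the overflow. Letters other than \<open>z\<close> and \<open>o1\<close> are kept, and among the digits they stop the carry.\<close>

fun counter_out :: "'x \<Rightarrow> 'x \<Rightarrow> counter_state \<times> 'x \<rightharpoonup> 'x" where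
  "counter_out z o1 (Prefix n, x) = Some x"
| "counter_out z o1 (Carry 0, x) = None"
| "counter_out z o1 (Carry (Suc n), x) = Some (transpose z o1 x)"
| "counter_out z o1 (Copy, x) = Some x"

abbreviation counter :: "'x \<Rightarrow> 'x \<Rightarrow> counter_state \<Rightarrow> 'x list \<rightharpoonup> 'x list" where
  "counter z o1 \<equiv> automaton_map (\<lambda>p. Some (counter_next z o1 p)) (counter_out z o1)"

lemma counter_in_ISA: "counter z o1 q \<in> carrier ISA"
proof -
  have "x = x'" if "counter_out z o1 (s, x) \<noteq> None"
    "counter_out z o1 (s, x) = counter_out z o1 (s, x')" for s x x'
  proof (cases s)
    case (Carry n)
    with that show ?thesis by (cases n) (auto dest: transpose_eq_imp_eq)
  qed (use that in auto)
  then have "inj_on (counter z o1 q) (dom (counter z o1 q))"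
    by (rule inj_on_automaton_map)
  moreover have "initial_automaton UNIV (\<lambda>p. Some (counter_next z o1 p)) (counter_out z o1) q"
    by (simp add: initial_automaton_def)
  from automaton_map_realizable[OF this]
  have "\<exists>(Q :: 'a list set) \<phi> \<psi> q0. initial_automaton Q \<phi> \<psi> q0 \<and> counter z o1 q = automaton_map \<phi> \<psi> q0"
    by metis
  ultimately show ?thesis
    by (simp add: ISA_def partial_automatic_permutation_def)
qed

lemma counter_Copy: "counter z o1 Copy u = Some u"
  by (induction u) (simp_all add: automaton_map_Nil automaton_map_Cons)

lemma counter_Prefix:
  assumes "z \<noteq> o1"
  shows "counter z o1 (Prefix m) (replicate n z @ o1 # u) =
    map_option (\<lambda>v. replicate n z @ o1 # v) (counter z o1 (Carry (m + n)) u)"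
proof (induction n arbitrary: m)
  case 0
  then show ?case using assms by (simp add: automaton_map_Cons)
next
  case (Suc n)
  from Suc[of "Suc m"] show ?case
    by (simp add: automaton_map_Cons option.map_comp comp_def)
qed

text \<open>
  Two increments restore the lowest digit and increment the rest, so each digit doubles the number of
  steps before the overflow.
\<close>

lemma counter_Carry_twice:
  assumes "z \<noteq> o1"
  shows "iterate (counter z o1 (Carry (Suc n))) 2 (z # u) =
    map_option ((#) z) (counter z o1 (Carry n) u)"
  using assms by (simp add: numeral_2_eq_2 iterate_Suc automaton_map_Cons counter_Copy)

lemma iterate_Carry:
  assumes "z \<noteq> o1"
  shows "iterate (counter z o1 (Carry n)) (2 ^ n - 1) (replicate (Suc n) z) \<noteq> None"
    and "iterate (counter z o1 (Carry n)) (2 ^ n) (replicate (Suc n) z) = None"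
proof (induction n)
  case 0
  show "iterate (counter z o1 (Carry 0)) (2 ^ 0 - 1) (replicate (Suc 0) z) \<noteq> None"
    and "iterate (counter z o1 (Carry 0)) (2 ^ 0) (replicate (Suc 0) z) = None"
    by (simp_all add: iterate_Suc automaton_map_Cons)
next
  case (Suc n)
  let ?f = "counter z o1 (Carry (Suc n))"
  have double: "iterate ?f (2 * k) (z # u) = map_option ((#) z) (iterate (counter z o1 (Carry n)) k u)"
    for k u
    unfolding iterate_mult by (rule iterate_semiconjugate) (rule counter_Carry_twice[OF assms])
  show "iterate ?f (2 ^ Suc n) (replicate (Suc (Suc n)) z) = None"
    using double[of "2 ^ n" "replicate (Suc n) z"] Suc.IH(2) by simp
  obtain v where v: "iterate ?f (2 * (2 ^ n - 1)) (replicate (Suc (Suc n)) z) = Some (z # v)"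
    using double[of "2 ^ n - 1" "replicate (Suc n) z"] Suc.IH(1) by auto
  have "2 ^ Suc n - 1 = Suc (2 * (2 ^ n - 1 :: nat))"
    unfolding power_Suc using one_le_power[of "2 :: nat" n, OF one_le_numeral] by linarith
  then show "iterate ?f (2 ^ Suc n - 1) (replicate (Suc (Suc n)) z) \<noteq> None"
    using v by (simp add: iterate_Suc automaton_map_Cons counter_Copy assms)
qed

lemma not_bounded_transience_counter:
  assumes "z \<noteq> o1"
  shows "\<not> bounded_transience (counter z o1 (Prefix 0))"
proof
  assume "bounded_transience (counter z o1 (Prefix 0))"
  then obtain k where k: "\<And>w m. iterate (counter z o1 (Prefix 0)) k w \<noteq> None \<Longrightarrow>
      iterate (counter z o1 (Prefix 0)) m w \<noteq> None"
    unfolding bounded_transience_def by blast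
  have prefix: "iterate (counter z o1 (Prefix 0)) m (replicate k z @ o1 # u) =
      map_option (\<lambda>v. replicate k z @ o1 # v) (iterate (counter z o1 (Carry k)) m u)" for m u
    by (rule iterate_semiconjugate) (simp add: counter_Prefix[OF assms])
  have "k \<le> 2 ^ k - 1"
    using less_exp[of k] by linarith
  with iterate_Carry(1)[OF assms, of k]
  have "iterate (counter z o1 (Carry k)) k (replicate (Suc k) z) \<noteq> None"
    by (rule iterate_mono_domain)
  then have "iterate (counter z o1 (Prefix 0)) (2 ^ k) (replicate k z @ o1 # replicate (Suc k) z) \<noteq> None"
    using k[of "replicate k z @ o1 # replicate (Suc k) z" "2 ^ k"] by (simp add: prefix)
  then show False
    using iterate_Carry(2)[OF assms, of k] by (simp add: prefix)
qed

section \<open>A conjugacy class without group elements\<close>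

theorem corollary8:
  assumes "CARD('x::finite) \<ge> 2"
  shows "\<exists>C \<in> carrier (ISA :: ('x list \<rightharpoonup> 'x list) monoid) // conjugacy ISA.
           \<forall>a\<in>C. \<not> group_element ISA a"
proof -
  obtain z o1 :: 'x where "z \<noteq> o1"
    using assms card_le_Suc0_iff_eq[of "UNIV :: 'x set"] by fastforce
  let ?a = "counter z o1 (Prefix 0)"
  have "conjugacy ISA `` {?a} \<in> carrier ISA // conjugacy ISA"
    by (rule quotientI) (rule counter_in_ISA)
  moreover have "\<not> group_element ISA b" if "b \<in> conjugacy ISA `` {?a}" for b
  proof
    assume "group_element ISA b"
    then have "bounded_transience ?a"
      using that conjugacy_bounded_transience group_element_bounded_transience by blast
    with not_bounded_transience_counter[OF \<open>z \<noteq> o1\<close>] show False ..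
  qed
  ultimately show ?thesis by blast
qed

end
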